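(* Let $m,n,p\geq 1$ be integers with $p<\min\{m,n\}$, let $\epsilon=(\epsilon_1,\ldots,\epsilon_p)\in\{1,-1\}^p$, and let $A\in\mathbb{R}^{m\times n}$ be an SSR$_p(\epsilon)$ matrix. Then for each of the four borders of $A$ (left, right, top, bottom) one can add a line at that border (a new first column, a new last column, a new first row, or a new last row, with real entries, the entries of $A$ being left unchanged) such that the resulting matrix is SSR$_p(\epsilon)$.
   Context: All matrices are real. For integers $m,n\geq p\geq 1$ and $\epsilon=(\epsilon_1,\ldots,\epsilon_p)\in\{1,-1\}^p$, an $m\times n$ matrix is strictly sign regular of order $p$ with sign pattern $\epsilon$, written SSR$_p(\epsilon)$, if for every $1\leq k\leq p$ all its $k\times k$ minors are non-zero and have sign $\epsilon_k$. Here the $k\times k$ minors are the determinants of the submatrices with rows $I$ and columns $J$, $|I|=|J|=k$, rows and columns kept in increasing order. A "line" means a row or a column. *)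

theory Defs
  imports
    Complex_Main
    "Jordan_Normal_Form.Determinant"
    "Jordan_Normal_Form.DL_Submatrix"
begin

(* Rows and columns are indexed from 0, and submatrix keeps the selected ones in increasing
   order.  The sign pattern (eps_1, ..., eps_p) is a function on nat of which only the values
   at 1, ..., p are used. *)
definition strictly_sign_regular :: "nat \<Rightarrow> (nat \<Rightarrow> real) \<Rightarrow> real mat \<Rightarrow> bool" where
  "strictly_sign_regular p \<epsilon> A \<longleftrightarrow>
     1 \<le> p \<and> p \<le> dim_row A \<and> p \<le> dim_col A \<and>
     (\<forall>k\<in>{1..p}. \<forall>I J. I \<subseteq> {..<dim_row A} \<longrightarrow> J \<subseteq> {..<dim_col A} \<longrightarrow> card I = k \<longrightarrow> card J = k \<longrightarrow>
        det (submatrix A I J) \<noteq> 0 \<and> sgn (det (submatrix A I J)) = \<epsilon> k)"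

definition add_first_col :: "'a vec \<Rightarrow> 'a mat \<Rightarrow> 'a mat" where
  "add_first_col v A = mat_of_cols (dim_row A) (v # cols A)"

definition add_last_col :: "'a vec \<Rightarrow> 'a mat \<Rightarrow> 'a mat" where
  "add_last_col v A = mat_of_cols (dim_row A) (cols A @ [v])"

definition add_first_row :: "'a vec \<Rightarrow> 'a mat \<Rightarrow> 'a mat" where
  "add_first_row v A = mat_of_rows (dim_col A) (v # rows A)"

definition add_last_row :: "'a vec \<Rightarrow> 'a mat \<Rightarrow> 'a mat" where
  "add_last_row v A = mat_of_rows (dim_col A) (rows A @ [v])"

end

(* A new first column is taken as the combination sum_j (-d)^j a_j of the columns a_j of A,
   with d > 0 small.  A minor on this column and the columns in K is a combination of the
   numbers det [a_j, a_K]; those with j in K vanish, and the others are minors of A of the same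
   order, up to the sign (-1)^{#{a in K. a < j}}.  The smallest j outside K dominates as d
   tends to 0; all columns before it lie in K, so the sign (-1)^j of its weight cancels that of
   the minor.  Such a j exists because K has fewer than p <= n elements.  A new last column is
   obtained by mirroring the weights, and new rows by transposition. *)
theory Submission
  imports Defs
begin

section \<open>Submatrices and the increasing enumeration \<open>pick\<close> of an index
  set\<close>

lemma submatrix_carrier:
  assumes "I \<subseteq> {..<dim_row A}" "J \<subseteq> {..<dim_col A}"
  shows "submatrix A I J \<in> carrier_mat (card I) (card J)"
proof -
  have "{i. i < dim_row A \<and> i \<in> I} = I" "{j. j < dim_col A \<and> j \<in> J} = J"
    using assms by auto
  then show ?thesis by (simp add: submatrix_def)
qed

lemma submatrix_index':
  assumes "I \<subseteq> {..<dim_row A}" "J \<subseteq> {..<dim_col A}" "i < card I" "j < card J"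
  shows "submatrix A I J $$ (i, j) = A $$ (pick I i, pick J j)"
proof -
  have "{i. i < dim_row A \<and> i \<in> I} = I" "{j. j < dim_col A \<and> j \<in> J} = J"
    using assms by auto
  then show ?thesis using assms by (simp add: submatrix_index)
qed

lemma pick_less:
  assumes "I \<subseteq> {..<m}" "i < card I"
  shows "pick I i < m"
  using assms(1) pick_in_set_le[OF assms(2)] by auto

lemma submatrix_transpose:
  assumes "I \<subseteq> {..<dim_row A}" "J \<subseteq> {..<dim_col A}"
  shows "submatrix A\<^sup>T J I = (submatrix A I J)\<^sup>T"
proof -
  have "submatrix A\<^sup>T J I \<in> carrier_mat (card J) (card I)"
    using assms by (intro submatrix_carrier) auto
  moreover have "submatrix A I J \<in> carrier_mat (card I) (card J)"
    using assms by (rule submatrix_carrier)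
  ultimately show ?thesis
    using assms by (intro eq_matI) (auto simp: submatrix_index' pick_less)
qed

text \<open>\<open>pick\<close> is inverse to the rank \<open>card {a \<in> K. a < x}\<close>.
  Inserting \<open>j\<close> raises by one the rank of exactly the elements above \<open>j\<close>;
  this is the shift made by \<open>insert_index\<close> at the rank of \<open>j\<close>.\<close>

lemma pick_insert:
  assumes "finite K" "j \<notin> K" "c < card K"
  shows "pick (insert j K) (insert_index (card {a \<in> K. a < j}) c) = pick K c"
proof -
  let ?a = "pick K c"
  have a: "?a \<in> K" and ca: "card {a \<in> K. a < ?a} = c"
    using assms(3) by (simp_all add: pick_in_set_le card_pick_le)
  have "card {a \<in> insert j K. a < ?a} = insert_index (card {a \<in> K. a < j}) c"
  proof (cases "j < ?a")
    case True
    have "{a \<in> K. a < j} \<subseteq> {a \<in> K. a < ?a}" using True by auto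
    then have "card {a \<in> K. a < j} \<le> c"
      using card_mono[of "{a \<in> K. a < ?a}" "{a \<in> K. a < j}"] assms(1) ca by simp
    moreover have "{a \<in> insert j K. a < ?a} = insert j {a \<in> K. a < ?a}" using True by auto
    ultimately show ?thesis using assms ca by (simp add: insert_index_def)
  next
    case False
    then have ja: "?a < j" using a assms(2) by (metis linorder_neqE_nat)
    have "{a \<in> K. a < ?a} \<subset> {a \<in> K. a < j}" using ja a less_trans by blast
    then have "card {a \<in> K. a < ?a} < card {a \<in> K. a < j}"
      using assms(1) by (intro psubset_card_mono) simp_all
    then have "c < card {a \<in> K. a < j}" using ca by simp
    moreover have "{a \<in> insert j K. a < ?a} = {a \<in> K. a < ?a}" using False by auto
    ultimately show ?thesis using ca by (simp add: insert_index_def)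
  qed
  then show ?thesis using pick_card_in_set[of ?a "insert j K"] a by simp
qed

lemma pick_insert_new:
  "pick (insert j K) (card {a \<in> K. a < j}) = j"
proof -
  have "{a \<in> insert j K. a < j} = {a \<in> K. a < j}" by auto
  then show ?thesis using pick_card_in_set[of j "insert j K"] by simp
qed

text \<open>The shift by one preserves ranks. It is the renumbering of old columns when a new one is
  put in front.\<close>

lemma pick_Suc_image:
  assumes "c < card K"
  shows "pick (Suc ` K) c = Suc (pick K c)"
proof -
  have "{a \<in> Suc ` K. a < Suc (pick K c)} = Suc ` {a \<in> K. a < pick K c}" by auto
  then have "card {a \<in> Suc ` K. a < Suc (pick K c)} = c"
    using assms by (simp add: card_image card_pick_le)
  then show ?thesis
    using pick_card_in_set[of "Suc (pick K c)" "Suc ` K"] assms by (simp add: pick_in_set_le)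
qed

(* The determinant of (u | N), expanded along the column u. *)
definition det_cons :: "(nat \<Rightarrow> 'a::comm_ring_1) \<Rightarrow> 'a mat \<Rightarrow> 'a" where
  "det_cons u N = (\<Sum>i<dim_row N. u i * (-1) ^ i *
     det (mat (dim_row N - 1) (dim_col N) (\<lambda>(r, c). N $$ (insert_index i r, c))))"

section \<open>Determinants as functions of one bordering column\<close>

text \<open>Linearity in the bordering column: a minor through a weighted combination of columns
  becomes the weighted sum of the values at the single columns.\<close>

lemma det_cons_sum:
  "det_cons (\<lambda>i. \<Sum>j\<in>S. c j * f j i) N = (\<Sum>j\<in>S. c j * det_cons (f j) N)"
  unfolding det_cons_def sum_distrib_left sum_distrib_right mult.assoc
  by (rule sum.swap)

lemma det_cons_cong:
  assumes "\<And>i. i < dim_row N \<Longrightarrow> u i = v i"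
  shows "det_cons u N = det_cons v N"
  unfolding det_cons_def using assms by (intro sum.cong) auto

text \<open>Laplace expansion along column \<open>t\<close>, where \<open>N\<close> is
  \<open>M\<close> without that column. The cofactor sign is \<open>(-1) ^ (i + t)\<close>;
  \<open>det_cons\<close> carries the part with \<open>i\<close>, so \<open>(-1) ^ t\<close> remains
  in front.\<close>

lemma det_eq_det_cons:
  assumes M: "M \<in> carrier_mat (Suc k) (Suc k)" and t: "t \<le> k"
    and N: "N \<in> carrier_mat (Suc k) k"
    and MN: "\<And>i c. i < Suc k \<Longrightarrow> c < k \<Longrightarrow> M $$ (i, insert_index t c) = N $$ (i, c)"
  shows "det M = (-1) ^ t * det_cons (\<lambda>i. M $$ (i, t)) N"
proof -
  have del: "mat_delete M i t = mat k k (\<lambda>(r, c). N $$ (insert_index i r, c))"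
    if "i < Suc k" for i
  proof (rule eq_matI)
    fix r c
    assume "r < dim_row (mat k k (\<lambda>(r, c). N $$ (insert_index i r, c)))"
      and "c < dim_col (mat k k (\<lambda>(r, c). N $$ (insert_index i r, c)))"
    then have rc: "r < k" "c < k" by auto
    have "M $$ (insert_index i r, insert_index t c) = mat_delete M i t $$ (r, c)"
      using mat_delete_index[OF M that _ rc] t by simp
    moreover have "insert_index i r < Suc k" using rc by (simp add: insert_index_def)
    ultimately show "mat_delete M i t $$ (r, c)
        = mat k k (\<lambda>(r, c). N $$ (insert_index i r, c)) $$ (r, c)"
      using rc MN by simp
  qed (use M in auto)
  have "det M = (\<Sum>i<Suc k. M $$ (i, t) * cofactor M i t)"
    using laplace_expansion_column[OF M] t by simp
  also have "\<dots> = (-1) ^ t * det_cons (\<lambda>i. M $$ (i, t)) N"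
    unfolding det_cons_def sum_distrib_left
    using N by (intro sum.cong) (auto simp: cofactor_def del power_add)
  finally show ?thesis .
qed

lemma det_cons_col:
  assumes N: "N \<in> carrier_mat (Suc k) k" and c: "c < k"
  shows "det_cons (\<lambda>i. N $$ (i, c)) N = 0"
proof -
  \<comment> \<open>Column \<open>c\<close> of \<open>N\<close> is put in front, so it occurs in
    \<open>M\<close> at positions \<open>0\<close> and \<open>Suc c\<close>.\<close>
  define M where
    "M = mat (Suc k) (Suc k) (\<lambda>(i, j). if j = 0 then N $$ (i, c) else N $$ (i, j - 1))"
  have M: "M \<in> carrier_mat (Suc k) (Suc k)" by (simp add: M_def)
  have "det M = 0"
    by (rule det_identical_columns[OF M, of 0 "Suc c"])
      (use c in \<open>auto simp: M_def intro!: eq_vecI\<close>)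
  moreover have "det M = (-1) ^ 0 * det_cons (\<lambda>i. M $$ (i, 0)) N"
    by (rule det_eq_det_cons[OF M _ N]) (auto simp: M_def insert_index_def)
  moreover have "det_cons (\<lambda>i. M $$ (i, 0)) N = det_cons (\<lambda>i. N $$ (i, c)) N"
    using N by (intro det_cons_cong) (auto simp: M_def)
  ultimately show ?thesis by simp
qed

text \<open>Column \<open>j\<close> stands behind the columns of \<open>K\<close> that are smaller
  than \<open>j\<close>. Bringing it to the front costs one sign change for each of them.\<close>

lemma det_submatrix_insert:
  assumes I: "I \<subseteq> {..<dim_row A}" and K: "K \<subseteq> {..<dim_col A}"
    and j: "j < dim_col A" "j \<notin> K" and card: "card I = Suc (card K)"
  shows "det (submatrix A I (insert j K)) =
    (-1) ^ card {a \<in> K. a < j} * det_cons (\<lambda>i. A $$ (pick I i, j)) (submatrix A I K)"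
proof -
  let ?t = "card {a \<in> K. a < j}" and ?M = "submatrix A I (insert j K)"
  have fin: "finite K" using K finite_subset by blast
  have jK: "insert j K \<subseteq> {..<dim_col A}" using K j by auto
  have cardj: "card (insert j K) = Suc (card K)" using fin j by simp
  have t: "?t \<le> card K" using fin by (intro card_mono) auto
  have N: "submatrix A I K \<in> carrier_mat (Suc (card K)) (card K)"
    using submatrix_carrier[OF I K] card by simp
  have M: "?M \<in> carrier_mat (Suc (card K)) (Suc (card K))"
    using submatrix_carrier[OF I jK] card cardj by simp
  have "?M $$ (i, insert_index ?t c) = submatrix A I K $$ (i, c)"
    if "i < Suc (card K)" "c < card K" for i c
  proof -
    have "insert_index ?t c < Suc (card K)" using that by (simp add: insert_index_def)
    then show ?thesis
      using that fin j by (simp add: submatrix_index' I K jK card cardj pick_insert del: insert_subset)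
  qed
  then have "det ?M = (-1) ^ ?t * det_cons (\<lambda>i. ?M $$ (i, ?t)) (submatrix A I K)"
    by (rule det_eq_det_cons[OF M t N])
  also have "det_cons (\<lambda>i. ?M $$ (i, ?t)) (submatrix A I K)
      = det_cons (\<lambda>i. A $$ (pick I i, j)) (submatrix A I K)"
    using N t by (intro det_cons_cong)
      (simp add: submatrix_index' I jK card cardj pick_insert_new del: insert_subset)
  finally show ?thesis .
qed

text \<open>The bordering column repeats the column of the submatrix at position \<open>c\<close>,
  the rank of \<open>j\<close> in \<open>K\<close>.\<close>

lemma det_cons_submatrix_col:
  assumes I: "I \<subseteq> {..<dim_row A}" and K: "K \<subseteq> {..<dim_col A}"
    and j: "j \<in> K" and card: "card I = Suc (card K)"
  shows "det_cons (\<lambda>i. A $$ (pick I i, j)) (submatrix A I K) = 0"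
proof -
  define c where "c = card {a \<in> K. a < j}"
  have fin: "finite K" using K finite_subset by blast
  have N: "submatrix A I K \<in> carrier_mat (Suc (card K)) (card K)"
    using submatrix_carrier[OF I K] card by simp
  have "c < card K"
    unfolding c_def using fin j by (intro psubset_card_mono) auto
  moreover have "pick K c = j"
    unfolding c_def using j by (rule pick_card_in_set)
  ultimately have "det_cons (\<lambda>i. A $$ (pick I i, j)) (submatrix A I K)
      = det_cons (\<lambda>i. submatrix A I K $$ (i, c)) (submatrix A I K)"
    using N card by (intro det_cons_cong) (simp add: submatrix_index' I K)
  then show ?thesis using det_cons_col[OF N \<open>c < card K\<close>] by simp
qed

section \<open>The sign of an alternating polynomial close to zero\<close>

text \<open>The first nonzero coefficient decides: for \<open>x > 0\<close> the factor
  \<open>x ^ l\<close> can be split off without changing the sign, and what remains is continuous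
  with a positive value at \<open>0\<close>.\<close>

lemma eventually_alternating_sum_pos:
  fixes d :: "nat \<Rightarrow> real"
  assumes "l < n" "\<And>j. j < l \<Longrightarrow> d j = 0" "(-1) ^ l * d l > 0"
  shows "\<forall>\<^sub>F x in at_right 0. (\<Sum>j<n. (-x) ^ j * d j) > 0"
proof -
  \<comment> \<open>The quotient of the sum by \<open>x ^ l\<close>. For \<open>j < l\<close> the
    truncated exponent \<open>j - l\<close> is \<open>0\<close>, which does no harm because
    \<open>d j = 0\<close>; at \<open>0\<close> only the term \<open>j = l\<close> survives.\<close>
  define g where "g x = (\<Sum>j<n. (-1) ^ j * x ^ (j - l) * d j)" for x :: real
  have "(-1) ^ j * 0 ^ (j - l) * d j = (if j = l then (-1) ^ l * d l else 0)" for j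
    using assms(2)[of j] by (cases "j < l") (auto simp: power_0_left)
  then have g0: "g 0 = (-1) ^ l * d l"
    using assms(1) by (simp add: g_def sum.delta)
  have "continuous (at_right 0) g"
    unfolding g_def by (intro continuous_intros)
  then have "(g \<longlongrightarrow> g 0) (at_right 0)"
    by (simp add: continuous_within)
  then have "\<forall>\<^sub>F x in at_right 0. g x > 0"
    using order_tendstoD(1)[of g "g 0" "at_right 0" 0] g0 assms(3) by simp
  moreover have "\<forall>\<^sub>F x in at_right 0. x > (0::real)"
    by (rule eventually_at_right_less)
  ultimately show ?thesis
  proof eventually_elim
    case (elim x)
    have "(-x) ^ j * d j = x ^ l * ((-1) ^ j * x ^ (j - l) * d j)" for j
    proof (cases "j < l")
      case False
      then have "x ^ j = x ^ l * x ^ (j - l)" by (simp flip: power_add)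
      then show ?thesis by (simp add: power_minus[of x])
    qed (simp add: assms(2))
    then have "(\<Sum>j<n. (-x) ^ j * d j) = x ^ l * g x"
      unfolding g_def sum_distrib_left by (intro sum.cong) blast+
    then show ?case using elim by simp
  qed
qed

section \<open>Strict sign regularity as positivity of signed minors\<close>

text \<open>For a sign \<open>\<epsilon> k\<close>, one strict inequality encodes both non-vanishing
  and the correct sign. In this form the condition can be obtained from a limit.\<close>

lemma strictly_sign_regularI:
  assumes "1 \<le> p" "p \<le> dim_row A" "p \<le> dim_col A" "\<forall>k\<in>{1..p}. \<epsilon> k \<in> {1, -1}"
    and "\<And>I J. I \<subseteq> {..<dim_row A} \<Longrightarrow> J \<subseteq> {..<dim_col A} \<Longrightarrow> card I = card J \<Longrightarrow>
      card J \<in> {1..p} \<Longrightarrow> \<epsilon> (card J) * det (submatrix A I J) > 0"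
  shows "strictly_sign_regular p \<epsilon> A"
  unfolding strictly_sign_regular_def
proof (intro conjI ballI allI impI)
  fix k I J
  assume k: "k \<in> {1..p}" and IJ: "I \<subseteq> {..<dim_row A}" "J \<subseteq> {..<dim_col A}"
    "card I = k" "card J = k"
  have "\<epsilon> k * det (submatrix A I J) > 0" "\<epsilon> k \<in> {1, -1}"
    using assms(4) assms(5)[of I J] k IJ by auto
  then show "det (submatrix A I J) \<noteq> 0" "sgn (det (submatrix A I J)) = \<epsilon> k"
    by auto
qed (use assms in auto)

text \<open>The product of a nonzero number with its own sign is its absolute value.\<close>

lemma strictly_sign_regular_det_pos:
  assumes "strictly_sign_regular p \<epsilon> A" "I \<subseteq> {..<dim_row A}" "J \<subseteq> {..<dim_col A}"
    "card I = card J" "card J \<in> {1..p}"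
  shows "\<epsilon> (card J) * det (submatrix A I J) > 0"
proof -
  have "det (submatrix A I J) \<noteq> 0" "sgn (det (submatrix A I J)) = \<epsilon> (card J)"
    using assms unfolding strictly_sign_regular_def by blast+
  then show ?thesis by (metis abs_sgn mult.commute zero_less_abs_iff)
qed

lemma strictly_sign_regular_transpose:
  assumes "strictly_sign_regular p \<epsilon> A"
  shows "strictly_sign_regular p \<epsilon> A\<^sup>T"
proof -
  have "det (submatrix A\<^sup>T I J) = det (submatrix A J I)"
    if "I \<subseteq> {..<dim_col A}" "J \<subseteq> {..<dim_row A}" "card I = k" "card J = k" for I J k
    using det_transpose[of "submatrix A J I" k] submatrix_carrier[of J A I]
      submatrix_transpose[of J A I] that by simp
  then show ?thesis
    using assms unfolding strictly_sign_regular_def by simp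
qed

section \<open>Minors of a matrix with an added border column\<close>

lemma add_first_col_carrier:
  "add_first_col v A \<in> carrier_mat (dim_row A) (Suc (dim_col A))"
  by (rule carrier_matI) (simp_all add: add_first_col_def)

lemma add_first_col_index:
  assumes "i < dim_row A" "j < Suc (dim_col A)"
  shows "add_first_col v A $$ (i, j) = (if j = 0 then v $ i else A $$ (i, j - 1))"
  using assms by (cases j) (auto simp: add_first_col_def mat_of_cols_index)

lemma add_last_col_carrier:
  "add_last_col v A \<in> carrier_mat (dim_row A) (Suc (dim_col A))"
  by (rule carrier_matI) (simp_all add: add_last_col_def)

lemma add_last_col_index:
  assumes "i < dim_row A" "j < Suc (dim_col A)"
  shows "add_last_col v A $$ (i, j) = (if j = dim_col A then v $ i else A $$ (i, j))"
  using assms by (auto simp: add_last_col_def mat_of_cols_index nth_append)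

lemma submatrix_add_first_col:
  assumes I: "I \<subseteq> {..<dim_row A}" and K: "K \<subseteq> {..<dim_col A}"
  shows "submatrix (add_first_col v A) I (Suc ` K) = submatrix A I K"
proof -
  have d: "dim_row (add_first_col v A) = dim_row A" "dim_col (add_first_col v A) = Suc (dim_col A)"
    using add_first_col_carrier[of v A] by auto
  have K': "Suc ` K \<subseteq> {..<Suc (dim_col A)}" using K by auto
  have c: "card (Suc ` K) = card K" by (simp add: card_image)
  show ?thesis
    using submatrix_carrier[of I "add_first_col v A" "Suc ` K"] submatrix_carrier[OF I K] I K' K
    by (intro eq_matI) (auto simp: d c submatrix_index' add_first_col_index pick_Suc_image pick_less)
qed

lemma submatrix_add_last_col:
  assumes I: "I \<subseteq> {..<dim_row A}" and K: "K \<subseteq> {..<dim_col A}"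
  shows "submatrix (add_last_col v A) I K = submatrix A I K"
proof -
  have d: "dim_row (add_last_col v A) = dim_row A" "dim_col (add_last_col v A) = Suc (dim_col A)"
    using add_last_col_carrier[of v A] by auto
  have K': "K \<subseteq> {..<Suc (dim_col A)}" using K by auto
  have "pick K c \<noteq> dim_col A" if "c < card K" for c using pick_less[OF K that] by simp
  then show ?thesis
    using submatrix_carrier[of I "add_last_col v A" K] submatrix_carrier[OF I K] I K' K
    by (intro eq_matI)
      (auto simp: d submatrix_index' add_last_col_index pick_less less_Suc_eq)
qed

text \<open>No column precedes the new one, so no sign appears.\<close>

lemma det_submatrix_add_first_col:
  assumes I: "I \<subseteq> {..<dim_row A}" and K: "K \<subseteq> {..<dim_col A}" and card: "card I = Suc (card K)"
  shows "det (submatrix (add_first_col v A) I (insert 0 (Suc ` K)))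
    = det_cons (\<lambda>i. v $ pick I i) (submatrix A I K)"
proof -
  let ?B = "add_first_col v A"
  have d: "dim_row ?B = dim_row A" "dim_col ?B = Suc (dim_col A)"
    using add_first_col_carrier[of v A] by auto
  have "det (submatrix ?B I (insert 0 (Suc ` K)))
      = det_cons (\<lambda>i. ?B $$ (pick I i, 0)) (submatrix A I K)"
    using det_submatrix_insert[of I ?B "Suc ` K" 0] I K card
    by (auto simp: d card_image submatrix_add_first_col image_subset_iff subset_iff)
  also have "\<dots> = det_cons (\<lambda>i. v $ pick I i) (submatrix A I K)"
    using submatrix_carrier[OF I K] I
    by (intro det_cons_cong) (auto simp: add_first_col_index pick_less)
  finally show ?thesis .
qed

text \<open>All columns of \<open>K\<close> precede the new one, whose index is
  \<open>dim_col A\<close>; hence the sign \<open>(-1) ^ card K\<close>.\<close>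

lemma det_submatrix_add_last_col:
  assumes I: "I \<subseteq> {..<dim_row A}" and K: "K \<subseteq> {..<dim_col A}" and card: "card I = Suc (card K)"
  shows "det (submatrix (add_last_col v A) I (insert (dim_col A) K))
    = (-1) ^ card K * det_cons (\<lambda>i. v $ pick I i) (submatrix A I K)"
proof -
  let ?B = "add_last_col v A"
  have d: "dim_row ?B = dim_row A" "dim_col ?B = Suc (dim_col A)"
    using add_last_col_carrier[of v A] by auto
  have "{a \<in> K. a < dim_col A} = K" using K by auto
  then have "det (submatrix ?B I (insert (dim_col A) K))
      = (-1) ^ card K * det_cons (\<lambda>i. ?B $$ (pick I i, dim_col A)) (submatrix A I K)"
    using det_submatrix_insert[of I ?B K "dim_col A"] I K card
      submatrix_add_last_col[OF I K, of v]
    by (auto simp: d subset_iff less_Suc_eq)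
  also have "det_cons (\<lambda>i. ?B $$ (pick I i, dim_col A)) (submatrix A I K)
      = det_cons (\<lambda>i. v $ pick I i) (submatrix A I K)"
    using submatrix_carrier[OF I K] I
    by (intro det_cons_cong) (auto simp: add_last_col_index pick_less)
  finally show ?thesis .
qed

section \<open>Signs of the minors through the new column for small weights\<close>

text \<open>Bordering by a column \<open>j\<close> outside \<open>K\<close> yields, up to the sign
  of the reordering, a minor of \<open>A\<close> of order \<open>card I \<le> p\<close>, whose sign
  is known.\<close>

lemma det_cons_submatrix_pos:
  assumes ssr: "strictly_sign_regular p \<epsilon> A"
    and I: "I \<subseteq> {..<dim_row A}" and K: "K \<subseteq> {..<dim_col A}"
    and card: "card I = Suc (card K)" "card I \<le> p" and j: "j < dim_col A" "j \<notin> K"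
  shows "(-1) ^ card {a \<in> K. a < j} *
    (\<epsilon> (card I) * det_cons (\<lambda>i. A $$ (pick I i, j)) (submatrix A I K)) > 0"
proof -
  have fin: "finite K" using K finite_subset by blast
  then have "card (insert j K) = card I" using j card by simp
  then have "\<epsilon> (card I) * det (submatrix A I (insert j K)) > 0"
    using strictly_sign_regular_det_pos[OF ssr I, of "insert j K"] K j card by auto
  then show ?thesis
    using det_submatrix_insert[OF I K j card(1)] by (simp add: mult.left_commute)
qed

lemma eventually_first_col_pos:
  assumes ssr: "strictly_sign_regular p \<epsilon> A"
    and I: "I \<subseteq> {..<dim_row A}" and K: "K \<subseteq> {..<dim_col A}"
    and card: "card I = Suc (card K)" "card I \<le> p"
  shows "\<forall>\<^sub>F x in at_right 0. \<epsilon> (card I) *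
    det_cons (\<lambda>i. \<Sum>j<dim_col A. (-x) ^ j * A $$ (pick I i, j)) (submatrix A I K) > 0"
proof -
  let ?n = "dim_col A"
  define d where "d j = \<epsilon> (card I) * det_cons (\<lambda>i. A $$ (pick I i, j)) (submatrix A I K)" for j
  have fin: "finite K" using K finite_subset by blast
  have "p \<le> ?n" using ssr by (simp add: strictly_sign_regular_def)
  \<comment> \<open>Some column lies outside \<open>K\<close>, since \<open>card K < card I\<close>
    and \<open>card I \<le> p \<le> ?n\<close>.\<close>
  then have "card K < card {..<?n}" using card by simp
  then obtain j where j: "j < ?n" "j \<notin> K" using card_mono[OF fin, of "{..<?n}"] by force
  define l where "l = (LEAST j. j \<notin> K)"
  have l: "l \<notin> K" unfolding l_def using j(2) by (rule LeastI)
  have "l < ?n" unfolding l_def using j Least_le[of "\<lambda>j. j \<notin> K" j] by simp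
  have below: "a \<in> K" if "a < l" for a using that not_less_Least unfolding l_def by blast
  \<comment> \<open>Exactly \<open>l\<close> columns of \<open>K\<close> precede \<open>l\<close>,
    so the reordering sign is \<open>(-1) ^ l\<close>, the sign demanded of the leading
    coefficient.\<close>
  then have "{a \<in> K. a < l} = {..<l}" by auto
  then have "(-1) ^ l * d l > 0"
    using det_cons_submatrix_pos[OF ssr I K card \<open>l < ?n\<close> l] by (simp add: d_def)
  moreover have "d a = 0" if "a < l" for a
    using det_cons_submatrix_col[OF I K below[OF that] card(1)] by (simp add: d_def)
  ultimately have "\<forall>\<^sub>F x in at_right 0. (\<Sum>j<?n. (-x) ^ j * d j) > 0"
    using \<open>l < ?n\<close> by (intro eventually_alternating_sum_pos)
  then show ?thesis
    by (simp add: det_cons_sum d_def sum_distrib_left mult.left_commute)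
qed

text \<open>With the weights reversed, the largest column outside \<open>K\<close> dominates. The
  columns of \<open>K\<close> behind it account for the difference between
  \<open>(-1) ^ card K\<close> and the reordering sign.\<close>

lemma eventually_last_col_pos:
  assumes ssr: "strictly_sign_regular p \<epsilon> A"
    and I: "I \<subseteq> {..<dim_row A}" and K: "K \<subseteq> {..<dim_col A}"
    and card: "card I = Suc (card K)" "card I \<le> p"
  shows "\<forall>\<^sub>F x in at_right 0. \<epsilon> (card I) * ((-1) ^ card K *
    det_cons (\<lambda>i. \<Sum>j<dim_col A. (-x) ^ (dim_col A - Suc j) * A $$ (pick I i, j))
      (submatrix A I K)) > 0"
proof -
  let ?n = "dim_col A"
  define e where "e j = \<epsilon> (card I) * det_cons (\<lambda>i. A $$ (pick I i, j)) (submatrix A I K)" for j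
  \<comment> \<open>Coefficients in reversed order: index \<open>j\<close> counts columns from the
    right end, so that the powers of \<open>-x\<close> increase again.\<close>
  define d where "d j = (-1) ^ card K * e (?n - Suc j)" for j
  have fin: "finite K" using K finite_subset by blast
  have "p \<le> ?n" using ssr by (simp add: strictly_sign_regular_def)
  then have "card K < card {..<?n}" using card by simp
  then obtain j where j: "j < ?n" "j \<notin> K" using card_mono[OF fin, of "{..<?n}"] by force
  \<comment> \<open>The bound \<open>i < ?n\<close> keeps the truncated difference faithful:
    \<open>?n - Suc l\<close> is the largest column outside \<open>K\<close>, and exactly
    \<open>l\<close> columns lie to its right.\<close>
  define l where "l = (LEAST i. i < ?n \<and> ?n - Suc i \<notin> K)"
  have ex: "?n - Suc j < ?n \<and> ?n - Suc (?n - Suc j) \<notin> K" using j by simp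
  have l: "l < ?n \<and> ?n - Suc l \<notin> K" unfolding l_def using ex by (rule LeastI)
  have below: "?n - Suc a \<in> K" if "a < l" for a
    using that l not_less_Least[of a "\<lambda>i. i < ?n \<and> ?n - Suc i \<notin> K"] unfolding l_def by force
  let ?j = "?n - Suc l"
  have "a \<in> K" if "?j < a" "a < ?n" for a
    using below[of "?n - Suc a"] that by simp
  then have K_split: "K = {a \<in> K. a < ?j} \<union> {?j<..<?n}"
    using K l by (auto simp: not_less le_less)
  have "card K = card {a \<in> K. a < ?j} + card {?j<..<?n}"
    by (subst K_split, rule card_Un_disjoint) (use fin in auto)
  then have cK: "card K = card {a \<in> K. a < ?j} + l" using l by simp
  \<comment> \<open>The \<open>l\<close> columns of \<open>K\<close> to the right of
    \<open>?j\<close> contribute \<open>(-1) ^ l\<close> to \<open>(-1) ^ card K\<close>; this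
    cancels the \<open>(-1) ^ l\<close> of the leading weight.\<close>
  have "(-1) ^ l * d l = (-1) ^ (l + l) * ((-1) ^ card {a \<in> K. a < ?j} * e ?j)"
    by (simp add: d_def cK power_add)
  also have "\<dots> > 0"
    using det_cons_submatrix_pos[OF ssr I K card, of ?j] l
    by (simp add: e_def flip: mult_2)
  finally have "(-1) ^ l * d l > 0" .
  moreover have "d a = 0" if "a < l" for a
    using det_cons_submatrix_col[OF I K below[OF that] card(1)] by (simp add: d_def e_def)
  ultimately have "\<forall>\<^sub>F x in at_right 0. (\<Sum>j<?n. (-x) ^ j * d j) > 0"
    using l by (intro eventually_alternating_sum_pos) auto
  moreover have "(\<Sum>j<?n. (-x) ^ j * d j) = \<epsilon> (card I) * ((-1) ^ card K *
    det_cons (\<lambda>i. \<Sum>j<?n. (-x) ^ (?n - Suc j) * A $$ (pick I i, j)) (submatrix A I K))" for x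
  proof -
    have "(\<Sum>j<?n. (-x) ^ j * d j) = (\<Sum>j<?n. (-x) ^ (?n - Suc j) * d (?n - Suc j))"
      by (rule sum.nat_diff_reindex[symmetric])
    also have "\<dots> = (\<Sum>j<?n. (-x) ^ (?n - Suc j) * ((-1) ^ card K * e j))"
      by (intro sum.cong) (auto simp: d_def)
    finally show ?thesis
      by (simp add: det_cons_sum e_def sum_distrib_left mult.left_commute)
  qed
  ultimately show ?thesis by simp
qed

section \<open>Existence of the new columns\<close>

text \<open>Each minor through the new column has the right sign for all small \<open>x > 0\<close>.
  There are finitely many such minors, so one \<open>x\<close> serves them all; the other minors are
  minors of \<open>A\<close>.\<close>

lemma ex_add_first_col:
  assumes ssr: "strictly_sign_regular p \<epsilon> A" and \<epsilon>: "\<forall>k\<in>{1..p}. \<epsilon> k \<in> {1, -1}"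
  shows "\<exists>v\<in>carrier_vec (dim_row A). strictly_sign_regular p \<epsilon> (add_first_col v A)"
proof -
  let ?m = "dim_row A" and ?n = "dim_col A"
  have p: "1 \<le> p" "p \<le> ?m" "p \<le> ?n" using ssr by (auto simp: strictly_sign_regular_def)
  \<comment> \<open>The index pairs of the minors through the new column: \<open>I\<close> gives the
    rows, \<open>K\<close> the remaining columns in the numbering of \<open>A\<close>.\<close>
  define P where "P = {(I, K). I \<subseteq> {..<?m} \<and> K \<subseteq> {..<?n} \<and> card I = Suc (card K) \<and> card I \<le> p}"
  have "finite P"
    by (rule finite_subset[of _ "Pow {..<?m} \<times> Pow {..<?n}"]) (auto simp: P_def)
  have "\<forall>\<^sub>F x in at_right 0. \<epsilon> (card I) *
      det_cons (\<lambda>i. \<Sum>j<?n. (-x) ^ j * A $$ (pick I i, j)) (submatrix A I K) > 0"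
    if "(I, K) \<in> P" for I K
    using that eventually_first_col_pos[OF ssr, of I K] by (simp add: P_def)
  then have "\<forall>\<^sub>F x in at_right 0. \<forall>(I, K)\<in>P. \<epsilon> (card I) *
      det_cons (\<lambda>i. \<Sum>j<?n. (-x) ^ j * A $$ (pick I i, j)) (submatrix A I K) > 0"
    using \<open>finite P\<close> by (intro eventually_ball_finite) auto
  from eventually_happens'[OF trivial_limit_at_right_real this]
  obtain x where "\<forall>(I, K)\<in>P. \<epsilon> (card I) *
      det_cons (\<lambda>i. \<Sum>j<?n. (-x) ^ j * A $$ (pick I i, j)) (submatrix A I K) > 0"
    ..
  then have x: "(I, K) \<in> P \<Longrightarrow> \<epsilon> (card I) *
      det_cons (\<lambda>i. \<Sum>j<?n. (-x) ^ j * A $$ (pick I i, j)) (submatrix A I K) > 0" for I K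
    by blast
  define v where "v = vec ?m (\<lambda>i. \<Sum>j<?n. (-x) ^ j * A $$ (i, j))"
  let ?B = "add_first_col v A"
  have d: "dim_row ?B = ?m" "dim_col ?B = Suc ?n"
    using add_first_col_carrier[of v A] by auto
  have "strictly_sign_regular p \<epsilon> ?B"
  proof (rule strictly_sign_regularI[OF _ _ _ \<epsilon>])
    fix I J assume "I \<subseteq> {..<dim_row ?B}" "J \<subseteq> {..<dim_col ?B}"
      and card: "card I = card J" "card J \<in> {1..p}"
    then have I: "I \<subseteq> {..<?m}" and J: "J \<subseteq> {..<Suc ?n}" by (auto simp: d)
    \<comment> \<open>Back to the column numbering of \<open>A\<close>: the old column
      \<open>a\<close> is column \<open>Suc a\<close> of \<open>?B\<close>, and index
      \<open>0\<close>, the new column, is dropped.\<close>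
    define K where "K = {a. Suc a \<in> J}"
    have K: "K \<subseteq> {..<?n}" using J by (auto simp: K_def)
    then have fin: "finite K" using finite_subset by blast
    have c: "card (Suc ` K) = card K" by (simp add: card_image)
    show "\<epsilon> (card J) * det (submatrix ?B I J) > 0"
    proof (cases "0 \<in> J")
      case True
      have "a \<in> insert 0 (Suc ` K)" if "a \<in> J" for a
        using that by (cases a) (auto simp: K_def)
      then have JK: "J = insert 0 (Suc ` K)" using True by (auto simp: K_def)
      then have cI: "card I = Suc (card K)" using card c fin by simp
      then have "\<epsilon> (card I) *
          det_cons (\<lambda>i. \<Sum>j<?n. (-x) ^ j * A $$ (pick I i, j)) (submatrix A I K) > 0"
        using I K card by (intro x) (auto simp: P_def)
      also have "det_cons (\<lambda>i. \<Sum>j<?n. (-x) ^ j * A $$ (pick I i, j)) (submatrix A I K)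
          = det_cons (\<lambda>i. v $ pick I i) (submatrix A I K)"
        using submatrix_carrier[OF I K] I
        by (intro det_cons_cong) (auto simp: v_def pick_less)
      finally show ?thesis
        using det_submatrix_add_first_col[OF I K cI] JK card by simp
    next
      case False
      have "a \<in> Suc ` K" if "a \<in> J" for a
        using that False by (cases a) (auto simp: K_def)
      then have JK: "J = Suc ` K" by (auto simp: K_def)
      then show ?thesis
        using strictly_sign_regular_det_pos[OF ssr I K] card c submatrix_add_first_col[OF I K]
        by simp
    qed
  qed (use p d in auto)
  moreover have "v \<in> carrier_vec ?m" by (simp add: v_def)
  ultimately show ?thesis by blast
qed

text \<open>The same choice of a common small \<open>x\<close>, now with the reversed weights and
  the sign \<open>(-1) ^ card K\<close> of a column in last position.\<close>

lemma ex_add_last_col: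
  assumes ssr: "strictly_sign_regular p \<epsilon> A" and \<epsilon>: "\<forall>k\<in>{1..p}. \<epsilon> k \<in> {1, -1}"
  shows "\<exists>v\<in>carrier_vec (dim_row A). strictly_sign_regular p \<epsilon> (add_last_col v A)"
proof -
  let ?m = "dim_row A" and ?n = "dim_col A"
  have p: "1 \<le> p" "p \<le> ?m" "p \<le> ?n" using ssr by (auto simp: strictly_sign_regular_def)
  define P where "P = {(I, K). I \<subseteq> {..<?m} \<and> K \<subseteq> {..<?n} \<and> card I = Suc (card K) \<and> card I \<le> p}"
  have "finite P"
    by (rule finite_subset[of _ "Pow {..<?m} \<times> Pow {..<?n}"]) (auto simp: P_def)
  have "\<forall>\<^sub>F x in at_right 0. \<epsilon> (card I) * ((-1) ^ card K *
      det_cons (\<lambda>i. \<Sum>j<?n. (-x) ^ (?n - Suc j) * A $$ (pick I i, j)) (submatrix A I K)) > 0"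
    if "(I, K) \<in> P" for I K
    using that eventually_last_col_pos[OF ssr, of I K] by (simp add: P_def)
  then have "\<forall>\<^sub>F x in at_right 0. \<forall>(I, K)\<in>P. \<epsilon> (card I) * ((-1) ^ card K *
      det_cons (\<lambda>i. \<Sum>j<?n. (-x) ^ (?n - Suc j) * A $$ (pick I i, j)) (submatrix A I K)) > 0"
    using \<open>finite P\<close> by (intro eventually_ball_finite) auto
  from eventually_happens'[OF trivial_limit_at_right_real this]
  obtain x where "\<forall>(I, K)\<in>P. \<epsilon> (card I) * ((-1) ^ card K *
      det_cons (\<lambda>i. \<Sum>j<?n. (-x) ^ (?n - Suc j) * A $$ (pick I i, j)) (submatrix A I K)) > 0"
    ..
  then have x: "(I, K) \<in> P \<Longrightarrow> \<epsilon> (card I) * ((-1) ^ card K *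
      det_cons (\<lambda>i. \<Sum>j<?n. (-x) ^ (?n - Suc j) * A $$ (pick I i, j)) (submatrix A I K)) > 0" for I K
    by blast
  define v where "v = vec ?m (\<lambda>i. \<Sum>j<?n. (-x) ^ (?n - Suc j) * A $$ (i, j))"
  let ?B = "add_last_col v A"
  have d: "dim_row ?B = ?m" "dim_col ?B = Suc ?n"
    using add_last_col_carrier[of v A] by auto
  have "strictly_sign_regular p \<epsilon> ?B"
  proof (rule strictly_sign_regularI[OF _ _ _ \<epsilon>])
    fix I J assume "I \<subseteq> {..<dim_row ?B}" "J \<subseteq> {..<dim_col ?B}"
      and card: "card I = card J" "card J \<in> {1..p}"
    then have I: "I \<subseteq> {..<?m}" and J: "J \<subseteq> {..<Suc ?n}" by (auto simp: d)
    \<comment> \<open>Old columns keep their numbers here; only the new index \<open>?n\<close> is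
      removed.\<close>
    define K where "K = J - {?n}"
    have K: "K \<subseteq> {..<?n}" using J by (auto simp: K_def)
    then have fin: "finite K" using finite_subset by blast
    show "\<epsilon> (card J) * det (submatrix ?B I J) > 0"
    proof (cases "?n \<in> J")
      case True
      then have JK: "J = insert ?n K" by (auto simp: K_def)
      moreover have "?n \<notin> K" by (simp add: K_def)
      ultimately have cI: "card I = Suc (card K)" using card fin by simp
      then have "\<epsilon> (card I) * ((-1) ^ card K *
          det_cons (\<lambda>i. \<Sum>j<?n. (-x) ^ (?n - Suc j) * A $$ (pick I i, j)) (submatrix A I K)) > 0"
        using I K card by (intro x) (auto simp: P_def)
      also have "det_cons (\<lambda>i. \<Sum>j<?n. (-x) ^ (?n - Suc j) * A $$ (pick I i, j)) (submatrix A I K)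
          = det_cons (\<lambda>i. v $ pick I i) (submatrix A I K)"
        using submatrix_carrier[OF I K] I
        by (intro det_cons_cong) (auto simp: v_def pick_less)
      finally show ?thesis
        using det_submatrix_add_last_col[OF I K cI] JK card by simp
    next
      case False
      then have "J = K" by (auto simp: K_def)
      then show ?thesis
        using strictly_sign_regular_det_pos[OF ssr I K] card submatrix_add_last_col[OF I K]
        by simp
    qed
  qed (use p d in auto)
  moreover have "v \<in> carrier_vec ?m" by (simp add: v_def)
  ultimately show ?thesis by blast
qed

section \<open>New rows by transposition, and the four borders together\<close>

lemma transpose_add_first_col: "(add_first_col v A\<^sup>T)\<^sup>T = add_first_row v A"
  unfolding add_first_col_def add_first_row_def transpose_mat_of_cols cols_transpose
    index_transpose_mat ..

lemma transpose_add_last_col: "(add_last_col v A\<^sup>T)\<^sup>T = add_last_row v A"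
  unfolding add_last_col_def add_last_row_def transpose_mat_of_cols cols_transpose
    index_transpose_mat ..

theorem mainTheorem3:
  fixes m n p :: nat and \<epsilon> :: "nat \<Rightarrow> real" and A :: "real mat"
  assumes "1 \<le> m" and "1 \<le> n" and "1 \<le> p" and "p < min m n"
    and "\<forall>k\<in>{1..p}. \<epsilon> k \<in> {1, -1}"
    and "A \<in> carrier_mat m n"
    and "strictly_sign_regular p \<epsilon> A"
  shows "(\<exists>v\<in>carrier_vec m. strictly_sign_regular p \<epsilon> (add_first_col v A)) \<and>
         (\<exists>v\<in>carrier_vec m. strictly_sign_regular p \<epsilon> (add_last_col v A)) \<and>
         (\<exists>v\<in>carrier_vec n. strictly_sign_regular p \<epsilon> (add_first_row v A)) \<and>
         (\<exists>v\<in>carrier_vec n. strictly_sign_regular p \<epsilon> (add_last_row v A))"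
proof -
  have ssrT: "strictly_sign_regular p \<epsilon> A\<^sup>T"
    using assms(7) by (rule strictly_sign_regular_transpose)
  \<comment> \<open>A column is added to the transpose, which has \<open>n\<close> rows, and the
    result is transposed back.\<close>
  have "\<exists>v\<in>carrier_vec n. strictly_sign_regular p \<epsilon> (add_first_row v A)"
    using ex_add_first_col[OF ssrT assms(5)] strictly_sign_regular_transpose assms(6)
    by (metis transpose_add_first_col carrier_matD(2) index_transpose_mat(2))
  moreover have "\<exists>v\<in>carrier_vec n. strictly_sign_regular p \<epsilon> (add_last_row v A)"
    using ex_add_last_col[OF ssrT assms(5)] strictly_sign_regular_transpose assms(6)
    by (metis transpose_add_last_col carrier_matD(2) index_transpose_mat(2))
  ultimately show ?thesis
    using ex_add_first_col[OF assms(7,5)] ex_add_last_col[OF assms(7,5)] assms(6) by simp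
qed

end
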